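(* Let $G$ and $H$ be bipartite graphs with bipartitions $(A_G,B_G)$ and $(A_H,B_H)$, respectively, such that $H$ is a bipartite correspondence-cover of $G$ with respect to some $L: A_G\to 2^{A_H},\ B_G\to 2^{B_H}$. Let $k_A,k_B\ge 1$ and $D_A,D_B\ge 0$ be integers, and let each of $\Delta_A,\Delta_B$ be a nonnegative integer or $\infty$. Assume that at least one of the following conditions holds: \begin{itemize} \item[(1)] $k_A\ge 2$ and $k_B \ge (e\,k_A D_B)^{1/(k_A-1)}D_A$; \item[(1$'$)] $k_B\ge 2$ and $k_A \ge (e\,k_B D_A)^{1/(k_B-1)}D_B$; \item[(2)] $e\bigl(k_AD_A(k_BD_B-1)+1\bigr) \bigl(1-(1-1/k_B)^{D_A}\bigr)^{k_A} \le 1$; \item[(2$'$)] $e\bigl(k_BD_B(k_AD_A-1)+1\bigr) \bigl(1-(1-1/k_A)^{D_B}\bigr)^{k_B} \le 1$; \item[(3)] $\Delta_A,\Delta_B<\infty$ and $e\bigl(\Delta_A(\Delta_B-1)+1\bigr) \bigl(1-(1-1/k_B)^{\Delta_A\min\{1,k_B/k_A\}}\bigr)^{k_A} \le 1$; \item[(3$'$)] $\Delta_A,\Delta_B<\infty$ and $e\bigl(\Delta_B(\Delta_A-1)+1\bigr) \bigl(1-(1-1/k_A)^{\Delta_B\min\{1,k_A/k_B\}}\bigr)^{k_B} \le 1$. \end{itemize} If the maximum degrees in $A_G$, $B_G$, $A_H$, $B_H$ are $\Delta_A$, $\Delta_B$, $D_A$, $D_B$, respectively, and $|L(v)|\ge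 k_A$ for all $v\in A_G$ and $|L(w)|\ge k_B$ for all $w\in B_G$, then $H$ admits an independent transversal with respect to $L$.
   Context: Graphs are simple and undirected. $e$ is the base of the natural logarithm. Let $G$ and $H$ be bipartite graphs with bipartitions $(A_G,B_G)$ and $(A_H,B_H)$. $H$ is a bipartite cover of $G$ with respect to a mapping $L:V(G)\to 2^{V(H)}$ if: (a) $L$ induces a partition of $V(H)$, i.e. the sets $L(v)$, $v\in V(G)$, are nonempty, pairwise disjoint and have union $V(H)$, and there are no edges of $H$ between $L(v)$ and $L(v')$ whenever $vv'\notin E(G)$; and (b) the sets $L(v)$, $v\in A_G$, partition $A_H$ and the sets $L(w)$, $w\in B_G$, partition $B_H$ (this is what is meant by writing $L: A_G\to 2^{A_H}, B_G\to 2^{B_H}$). It is a bipartite correspondence-cover if, in addition, for each edge $vv'\in E(G)$ the subgraph of $H$ between $L(v)$ and $L(v')$ is a matching (not necessarily perfect, possibly empty). An independent transversal of $H$ with respect to $L$ is an independent set of $H$ that contains exactly one vertex of each $L(v)$, $v\in V(G)$. The maximum degree in $A_G$ (resp. $B_G$) is the maximum degree in $G$ of the vertices in that part; the maximum degree in $A_H$ (resp. $B_H$) is the maximum degree in $H$ of the vertices in that part. The value $\infty$ for $\Delta_A$ or $\Delta_B$ means that no bound is imposed on the corresponding degrees. *)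

theory Defs
  imports Complex_Main "HOL-Library.Extended_Nat" "HOL-Library.Disjoint_Sets"
begin

record 'a ugraph =
  verts :: "'a set"
  edges :: "'a set set"

definition simple_graph :: "'a ugraph \<Rightarrow> bool" where
  "simple_graph G \<longleftrightarrow>
     (\<forall>e\<in>edges G. \<exists>u\<in>verts G. \<exists>v\<in>verts G. u \<noteq> v \<and> e = {u, v})"

definition bipartition :: "'a ugraph \<Rightarrow> 'a set \<Rightarrow> 'a set \<Rightarrow> bool" where
  "bipartition G A B \<longleftrightarrow>
     A \<inter> B = {} \<and> A \<union> B = verts G \<and>
     (\<forall>e\<in>edges G. \<exists>a\<in>A. \<exists>b\<in>B. e = {a, b})"

definition neighbours :: "'a ugraph \<Rightarrow> 'a \<Rightarrow> 'a set" where
  "neighbours G v = {u. {v, u} \<in> edges G}"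

text \<open>Graphs are not assumed finite, so sizes and degrees are valued in \<^typ>\<open>enat\<close>
  (\<^const>\<open>card\<close> would give 0 for infinite sets).\<close>

definition ecard :: "'a set \<Rightarrow> enat" where
  "ecard S = (if finite S then enat (card S) else \<infinity>)"

text \<open>The maximum degree over an empty part is 0. A finite supremum of degrees over a
  nonempty part is attained, so it is then indeed a maximum.\<close>

definition max_degree :: "'a ugraph \<Rightarrow> 'a set \<Rightarrow> enat" where
  "max_degree G S = (SUP v\<in>S. ecard (neighbours G v))"

definition edges_between :: "'a ugraph \<Rightarrow> 'a set \<Rightarrow> 'a set \<Rightarrow> 'a set set" where
  "edges_between G X Y = {e \<in> edges G. \<exists>x\<in>X. \<exists>y\<in>Y. e = {x, y}}"

definition matching :: "'a set set \<Rightarrow> bool" where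
  "matching M \<longleftrightarrow> pairwise disjnt M"

text \<open>In the last two conjuncts below, disjointness and nonemptiness of the sets in the
  partitions of the two parts of \<open>H\<close> are inherited from the first two conjuncts.\<close>

definition bipartite_cover ::
  "'a ugraph \<Rightarrow> 'a set \<Rightarrow> 'a set \<Rightarrow> 'b ugraph \<Rightarrow> 'b set \<Rightarrow> 'b set \<Rightarrow> ('a \<Rightarrow> 'b set) \<Rightarrow> bool" where
  "bipartite_cover G A\<^sub>G B\<^sub>G H A\<^sub>H B\<^sub>H L \<longleftrightarrow>
     (\<forall>v\<in>verts G. L v \<noteq> {}) \<and>
     disjoint_family_on L (verts G) \<and>
     (\<Union>v\<in>verts G. L v) = verts H \<and>
     (\<forall>v\<in>verts G. \<forall>v'\<in>verts G. {v, v'} \<notin> edges G \<longrightarrow> edges_between H (L v) (L v') = {}) \<and>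
     (\<Union>v\<in>A\<^sub>G. L v) = A\<^sub>H \<and>
     (\<Union>w\<in>B\<^sub>G. L w) = B\<^sub>H"

definition bipartite_correspondence_cover ::
  "'a ugraph \<Rightarrow> 'a set \<Rightarrow> 'a set \<Rightarrow> 'b ugraph \<Rightarrow> 'b set \<Rightarrow> 'b set \<Rightarrow> ('a \<Rightarrow> 'b set) \<Rightarrow> bool" where
  "bipartite_correspondence_cover G A\<^sub>G B\<^sub>G H A\<^sub>H B\<^sub>H L \<longleftrightarrow>
     bipartite_cover G A\<^sub>G B\<^sub>G H A\<^sub>H B\<^sub>H L \<and>
     (\<forall>v\<in>verts G. \<forall>v'\<in>verts G. {v, v'} \<in> edges G \<longrightarrow> matching (edges_between H (L v) (L v')))"

definition independent_set :: "'a ugraph \<Rightarrow> 'a set \<Rightarrow> bool" where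
  "independent_set G S \<longleftrightarrow> S \<subseteq> verts G \<and> (\<forall>x\<in>S. \<forall>y\<in>S. {x, y} \<notin> edges G)"

definition independent_transversal ::
  "'a ugraph \<Rightarrow> 'b ugraph \<Rightarrow> ('a \<Rightarrow> 'b set) \<Rightarrow> 'b set \<Rightarrow> bool" where
  "independent_transversal G H L T \<longleftrightarrow>
     independent_set H T \<and> (\<forall>v\<in>verts G. \<exists>!x. x \<in> T \<inter> L v)"

text \<open>Real power with the convention that the zeroth power of 0 is 1, whereas
  \<open>0 powr 0 = 0\<close>.\<close>

definition rpow :: "real \<Rightarrow> real \<Rightarrow> real" where
  "rpow x y = (if y = 0 then 1 else x powr y)"

end

theory Submission
  imports Defs "HOL-Analysis.Function_Topology" "HOL-Analysis.Convex"
begin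

text \<open>
  Each of the conditions comes with a mirror image in which the two sides change places, so
  it suffices to treat \<open>k = k\<^sub>A\<close> and \<open>l = k\<^sub>B\<close> (shrinking all lists to exactly these sizes)
  and to choose first on the side \<open>B\<close>. Pick a vertex \<open>f w\<close> of each list \<open>L w\<close>,
  \<open>w \<in> B\<close>, independently and uniformly. The choice extends to an independent transversal
  exactly when every list \<open>L v\<close>, \<open>v \<in> A\<close>, keeps a vertex with no chosen neighbour, because
  there are no edges inside \<open>A\<^sub>H\<close>. The bad events, that all of \<open>L v\<close> is hit, are local and
  rare, and the symmetric Lovasz local lemma (\<open>local_lemma_PiE\<close>) avoids them all.

  A vertex \<open>x\<close> joined to \<open>r x\<close> lists is missed with probability \<open>(1 - 1/l) ^ r x\<close>. By the matching
  condition a single choice hits at most one vertex of \<open>L v\<close>, so missing \<open>x\<close> can only help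
  to hit the others, and the events of hitting are negatively correlated:
  \<open>L v\<close> is completely hit with probability at most the product of \<open>1 - (1 - 1/l) ^ r x\<close> over
  \<open>x \<in> L v\<close> (\<open>card_all_hit_le\<close>). Now (2) follows from \<open>r x \<le> D\<^sub>A\<close>, and (3) from the bound
  \<open>\<Delta>\<^sub>A * min k l\<close> for the sum of all \<open>r x\<close> and from the concavity of
  \<open>t \<mapsto> ln (1 - q powr t)\<close>, in the form of two uses of the AM-GM inequality.
  For (1), the bad event at \<open>v\<close> is split according to an injection \<open>\<omega>\<close> that names for each
  \<open>x \<in> L v\<close> a list where it is hit. Each of these finer events has probability at most
  \<open>1 / l ^ k\<close>, and the gain is in the dependencies: two of them interact only if they name
  a common list, which leaves at most \<open>k * l * D\<^sub>B * D\<^sub>A ^ (k - 1)\<close> events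
  (\<open>extendable_if_few_witnesses\<close>).

  The graphs may be infinite, but the degrees in \<open>H\<close> are finite, hence
  every bad event depends on finitely many choices. The local lemma is therefore proved by
  counting for finitely many events, and Tychonoff's theorem gives the general case.
\<close>

section \<open>The local lemma for independent choices from finite sets\<close>

definition depends_on :: "'i set \<Rightarrow> (('i \<Rightarrow> 'b) \<Rightarrow> bool) \<Rightarrow> bool" where
  "depends_on N P \<longleftrightarrow> (\<forall>f g. (\<forall>i\<in>N. f i = g i) \<longrightarrow> P f = P g)"

lemma depends_onD: "depends_on N P \<Longrightarrow> (\<And>i. i \<in> N \<Longrightarrow> f i = g i) \<Longrightarrow> P f = P g"
  unfolding depends_on_def by blast

text \<open>This is the independence of events that read disjoint sets of coordinates, in counting form.\<close>

lemma card_PiE_independent: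
  assumes disj: "N \<inter> M = {}" and P: "depends_on N P" and Q: "depends_on M Q"
  shows "card {f \<in> PiE (N \<union> M) S. P f \<and> Q f} = card {f \<in> PiE N S. P f} * card {f \<in> PiE M S. Q f}"
proof -
  have P': "P (restrict f N) = P f" for f
    by (rule depends_onD[OF P]) auto
  have Q': "Q (restrict f M) = Q f" for f
    by (rule depends_onD[OF Q]) auto
  define glue where "glue = (\<lambda>(g, h) i. if i \<in> N then g i else (h i :: 'b))"
  have PN: "P (glue (g, h)) = P g" for g h
    by (rule depends_onD[OF P]) (auto simp: glue_def)
  have QM: "Q (glue (g, h)) = Q h" for g h
    by (rule depends_onD[OF Q]) (use disj in \<open>auto simp: glue_def\<close>)
  have "bij_betw (\<lambda>f. (restrict f N, restrict f M)) {f \<in> PiE (N \<union> M) S. P f \<and> Q f}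
      ({f \<in> PiE N S. P f} \<times> {f \<in> PiE M S. Q f})"
  proof (rule bij_betw_byWitness[where f' = glue])
    show "\<forall>f\<in>{f \<in> PiE (N \<union> M) S. P f \<and> Q f}. glue (restrict f N, restrict f M) = f"
    proof (intro ballI ext)
      fix f i assume "f \<in> {f \<in> PiE (N \<union> M) S. P f \<and> Q f}"
      then show "glue (restrict f N, restrict f M) i = f i"
        by (auto simp: glue_def PiE_def extensional_def)
    qed
    show "\<forall>gh\<in>{f \<in> PiE N S. P f} \<times> {f \<in> PiE M S. Q f}.
        (restrict (glue gh) N, restrict (glue gh) M) = gh"
      using disj by (fastforce simp: glue_def fun_eq_iff PiE_def extensional_def restrict_def)
    show "(\<lambda>f. (restrict f N, restrict f M)) ` {f \<in> PiE (N \<union> M) S. P f \<and> Q f}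
        \<subseteq> {f \<in> PiE N S. P f} \<times> {f \<in> PiE M S. Q f}"
      by (auto simp: P' Q')
    show "glue ` ({f \<in> PiE N S. P f} \<times> {f \<in> PiE M S. Q f})
        \<subseteq> {f \<in> PiE (N \<union> M) S. P f \<and> Q f}"
    proof clarify
      fix g h assume g: "g \<in> PiE N S" and h: "h \<in> PiE M S" and "P g" "Q h"
      then have "P (glue (g, h)) \<and> Q (glue (g, h))" by (simp add: PN QM)
      moreover have "glue (g, h) \<in> PiE (N \<union> M) S"
        using PiE_mem[OF g] PiE_mem[OF h] PiE_arb[OF h]
        by (intro PiE_I) (auto simp: glue_def)
      ultimately show "glue (g, h) \<in> PiE (N \<union> M) S \<and> P (glue (g, h)) \<and> Q (glue (g, h))"
        by blast
    qed
  qed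
  from bij_betw_same_card[OF this] show ?thesis
    by (simp add: card_cartesian_product)
qed

text \<open>Conditioned on avoiding the events in \<open>T\<close>, an event outside \<open>T\<close> has probability at
  most \<open>x\<close>. Split \<open>T\<close> into the neighbours of \<open>j\<close> and the rest: \<open>E j\<close> is independent of
  the rest, and by induction each of the at most \<open>d\<close> neighbours shrinks the surviving set by a
  factor of at least \<open>1 - x\<close>, a loss that the bound on \<open>p\<close> compensates. Probabilities are cardinalities, and conditioning is written without
  division because the surviving sets are not yet known to be nonempty.\<close>

lemma local_lemma_step:
  fixes \<Omega> :: "'o set" and E :: "'j \<Rightarrow> 'o set" and p x :: real
  defines "Av \<equiv> \<lambda>T. \<Omega> - \<Union>(E ` T)"
  assumes fin: "finite \<Omega>" "finite J"
    and indep: "\<And>j T. j \<in> J \<Longrightarrow> T \<subseteq> J - insert j (\<Gamma> j) \<Longrightarrow> card (Av T \<inter> E j) \<le> p * card (Av T)"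
    and deg: "\<And>j. j \<in> J \<Longrightarrow> card (J \<inter> \<Gamma> j) \<le> d"
    and px: "p \<le> x * (1 - x) ^ d" and x: "0 \<le> x" "x < 1"
  shows "j \<in> J \<Longrightarrow> T \<subseteq> J - {j} \<Longrightarrow> card (Av T \<inter> E j) \<le> x * card (Av T)"
proof (induction "card T" arbitrary: j T rule: less_induct)
  case less
  have finT: "finite T"
    using less.prems fin finite_subset by blast
  have finAv: "finite (Av U)" for U
    unfolding Av_def using fin by simp
  have grow: "(1 - x) ^ card U * card (Av R) \<le> card (Av (R \<union> U))"
    if "finite U" "R \<union> U \<subseteq> T" "R \<inter> U = {}" for R U
    using that
  proof (induction U)
    case (insert u U)
    have "R \<union> U \<subset> T" using insert by auto
    then have "card (R \<union> U) < card T"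
      using finT psubset_card_mono by blast
    then have hit: "card (Av (R \<union> U) \<inter> E u) \<le> x * card (Av (R \<union> U))"
      using insert less.prems by (intro less.hyps) auto
    have split: "Av (R \<union> insert u U) = Av (R \<union> U) - Av (R \<union> U) \<inter> E u"
      by (auto simp: Av_def)
    have "real (card (Av (R \<union> insert u U))) = card (Av (R \<union> U)) - card (Av (R \<union> U) \<inter> E u)"
      unfolding split using finAv
      by (subst card_Diff_subset) (auto simp: of_nat_diff card_mono)
    also have "\<dots> \<ge> (1 - x) * card (Av (R \<union> U))"
      using hit by (simp add: algebra_simps)
    finally have "(1 - x) * card (Av (R \<union> U)) \<le> card (Av (R \<union> insert u U))" .
    moreover have "(1 - x) ^ card (insert u U) * card (Av R)
        \<le> (1 - x) * card (Av (R \<union> U))"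
      using insert x by (auto simp: mult.assoc intro!: mult_left_mono)
    ultimately show ?case by linarith
  qed simp
  let ?S = "T \<inter> \<Gamma> j" and ?R = "T - \<Gamma> j"
  have cS: "card ?S \<le> d"
    using deg[OF less.prems(1)] less.prems(2) fin
    by (meson card_mono finite_Int Int_mono order_trans Diff_subset order_refl)
  have "real (card (Av T \<inter> E j)) \<le> card (Av ?R \<inter> E j)"
    using finAv by (intro of_nat_mono card_mono) (auto simp: Av_def)
  also have "\<dots> \<le> p * card (Av ?R)"
    using less.prems by (intro indep) auto
  also have "\<dots> \<le> (x * (1 - x) ^ d) * card (Av ?R)"
    using px by (intro mult_right_mono) auto
  also have "\<dots> \<le> (x * (1 - x) ^ card ?S) * card (Av ?R)"
    using x cS by (intro mult_right_mono mult_left_mono power_decreasing) auto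
  also have "\<dots> \<le> x * card (Av (?R \<union> ?S))"
    using grow[of ?S ?R] finT x by (auto simp: mult.assoc intro!: mult_left_mono)
  also have "?R \<union> ?S = T" by auto
  finally show ?case .
qed

lemma local_lemma:
  fixes \<Omega> :: "'o set" and E :: "'j \<Rightarrow> 'o set" and p x :: real
  assumes fin: "finite \<Omega>" "finite J" "\<Omega> \<noteq> {}"
    and indep: "\<And>j T. j \<in> J \<Longrightarrow> T \<subseteq> J - insert j (\<Gamma> j) \<Longrightarrow>
      card ((\<Omega> - \<Union>(E ` T)) \<inter> E j) \<le> p * card (\<Omega> - \<Union>(E ` T))"
    and deg: "\<And>j. j \<in> J \<Longrightarrow> card (J \<inter> \<Gamma> j) \<le> d"
    and px: "p \<le> x * (1 - x) ^ d" and x: "0 \<le> x" "x < 1"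
  shows "\<Omega> - \<Union>(E ` J) \<noteq> {}"
proof -
  have "finite T \<Longrightarrow> T \<subseteq> J \<Longrightarrow> 0 < card (\<Omega> - \<Union>(E ` T))" for T
  proof (induction T rule: finite_induct)
    case empty
    then show ?case using fin by (simp add: card_gt_0_iff)
  next
    case (insert j T)
    let ?V = "\<Omega> - \<Union>(E ` T)"
    have V: "0 < card ?V" using insert by auto
    have "real (card (?V \<inter> E j)) \<le> x * card ?V"
      using insert by (intro local_lemma_step[OF fin(1,2) indep deg px x]) auto
    also have "\<dots> < card ?V"
      using V x by simp
    finally have "card (?V \<inter> E j) < card ?V" by simp
    then have "?V \<inter> E j \<noteq> ?V" by auto
    then have "\<Omega> - \<Union>(E ` insert j T) \<noteq> {}" by auto
    then show ?case using fin by (simp add: card_gt_0_iff)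
  qed
  from this[of J] fin(2) show ?thesis by (metis card.empty less_irrefl order_refl)
qed

text \<open>The usual weight \<open>1 / (d + 1)\<close> works because \<open>(1 + 1/d) ^ d \<le> exp 1\<close>. It equals 1 for
  \<open>d = 0\<close>, where \<open>x < 1\<close> fails; there \<open>p\<close> itself is a weight,
  and it is less than 1 since \<open>exp 1 * p \<le> 1\<close>.\<close>

lemma symmetric_weight:
  fixes p :: real
  assumes p: "0 \<le> p" and epd: "exp 1 * (real d + 1) * p \<le> 1"
  obtains x where "p \<le> x * (1 - x) ^ d" "0 \<le> x" "x < 1"
proof (cases "d = 0")
  case True
  have "2 * p \<le> exp 1 * p"
    using p exp_ge_add_one_self[of 1] by (intro mult_right_mono) auto
  then have "p < 1" using epd True by simp
  then show ?thesis using that[of p] True p by simp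
next
  case False
  define x where "x = 1 / (real d + 1)"
  have "(1 + 1 / real d) ^ d \<le> exp (1 / real d) ^ d"
    using False by (intro power_mono) (auto intro: add_nonneg_nonneg)
  also have "\<dots> = exp 1"
    using False by (simp flip: exp_of_nat_mult)
  finally have e: "(1 + 1 / real d) ^ d \<le> exp 1" .
  have inv: "(1 - x) * (1 + 1 / real d) = 1"
  proof -
    have "1 - x = real d / (real d + 1)" by (simp add: x_def field_simps)
    moreover have "1 + 1 / real d = (real d + 1) / real d" using False by (simp add: field_simps)
    ultimately show ?thesis using False by simp
  qed
  then have "(1 - x) ^ d * (1 + 1 / real d) ^ d = 1"
    by (metis power_mult_distrib power_one)
  then have "1 \<le> (1 - x) ^ d * exp 1"
    using e False by (metis mult_left_mono x_def zero_le_power diff_ge_0_iff_ge le_add_same_cancel2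
        of_nat_0_le_iff divide_le_eq_1_pos add_pos_nonneg zero_less_one add.commute)
  moreover have "exp 1 * p \<le> x"
    using epd by (simp add: x_def field_simps)
  ultimately have "exp 1 * p * 1 \<le> x * ((1 - x) ^ d * exp 1)"
    using p by (intro mult_mono) (auto simp: x_def)
  then have "exp 1 * p \<le> exp 1 * (x * (1 - x) ^ d)"
    by (simp add: algebra_simps)
  then have "p \<le> x * (1 - x) ^ d" by simp
  then show ?thesis using that[of x] False by (simp add: x_def)
qed

text \<open>The product of the finite discrete spaces \<open>S i\<close> is compact by Tychonoff's theorem, and the choices
  that avoid a given event form a closed set, since the event reads finitely many
  coordinates.\<close>

lemma PiE_compactness:
  fixes S :: "'i \<Rightarrow> 'b set" and E :: "'j \<Rightarrow> ('i \<Rightarrow> 'b) \<Rightarrow> bool"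
  assumes finS: "\<And>i. i \<in> I \<Longrightarrow> finite (S i)"
    and N: "\<And>j. j \<in> J \<Longrightarrow> finite (N j) \<and> N j \<subseteq> I \<and> depends_on (N j) (E j)"
    and sat: "\<And>F. finite F \<Longrightarrow> F \<subseteq> J \<Longrightarrow> \<exists>f \<in> PiE I S. \<forall>j\<in>F. \<not> E j f"
  shows "\<exists>f \<in> PiE I S. \<forall>j\<in>J. \<not> E j f"
proof -
  define X where "X = product_topology (\<lambda>i. discrete_topology (S i)) I"
  have top: "topspace X = PiE I S" by (simp add: X_def)
  have comp: "compact_space X"
    using finS unfolding X_def
    by (auto simp: compact_space_product_topology compact_space_discrete_topology)
  define C where "C j = {f \<in> PiE I S. \<not> E j f}" for j
  have closed: "closedin X (C j)" if j: "j \<in> J" for j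
  proof -
    have "openin X {f \<in> PiE I S. E j f}"
    proof (subst openin_subopen, intro ballI)
      fix f assume f: "f \<in> {f \<in> PiE I S. E j f}"
      \<comment> \<open>the basic open set of all choices that agree with \<open>f\<close> where \<open>E j\<close> looks\<close>
      let ?U = "PiE I (\<lambda>i. if i \<in> N j then {f i} else S i)"
      have "openin X ?U"
        unfolding X_def
      proof (subst openin_PiE_gen, intro disjI2 conjI ballI)
        show "finite {i \<in> I. (if i \<in> N j then {f i} else S i) \<noteq> topspace (discrete_topology (S i))}"
          by (rule finite_subset[of _ "N j"]) (use N j in auto)
      qed (use f in auto)
      moreover have "f \<in> ?U" using f by (auto simp: PiE_def)
      moreover have "?U \<subseteq> {f \<in> PiE I S. E j f}"
      proof
        fix g assume g: "g \<in> ?U"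
        have "g \<in> PiE I S"
        proof (rule PiE_I)
          fix i assume "i \<in> I"
          then show "g i \<in> S i" using g f by (force simp: PiE_iff split: if_splits)
        qed (use g in \<open>auto simp: PiE_def extensional_def\<close>)
        moreover have "E j g = E j f"
        proof (rule depends_onD[of "N j" "E j"])
          show "depends_on (N j) (E j)" using N j by blast
          fix i assume i: "i \<in> N j"
          with N j have "i \<in> I" by blast
          with g i show "g i = f i" by (auto simp: PiE_def Pi_def split: if_splits)
        qed
        ultimately show "g \<in> {f \<in> PiE I S. E j f}" using f by auto
      qed
      ultimately show "\<exists>T. openin X T \<and> f \<in> T \<and> T \<subseteq> {f \<in> PiE I S. E j f}" by blast
    qed
    then have "closedin X (topspace X - {f \<in> PiE I S. E j f})" by blast
    also have "topspace X - {f \<in> PiE I S. E j f} = C j" by (auto simp: top C_def)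
    finally show ?thesis .
  qed
  \<comment> \<open>inserting the whole space makes the intersection a set of choices even if \<open>J\<close> is empty\<close>
  have "\<Inter>(insert (PiE I S) (C ` J)) \<noteq> {}"
  proof (rule comp[unfolded compact_space_fip, rule_format], intro conjI ballI allI impI)
    fix U assume "U \<in> insert (PiE I S) (C ` J)"
    then show "closedin X U" using closed closedin_topspace[of X] by (auto simp: top)
  next
    fix \<F> assume F: "finite \<F> \<and> \<F> \<subseteq> insert (PiE I S) (C ` J)"
    then have "finite (\<F> - {PiE I S})" "\<F> - {PiE I S} \<subseteq> C ` J" by auto
    then obtain K where K: "K \<subseteq> J" "finite K" "\<F> - {PiE I S} = C ` K"
      by (meson finite_subset_image)
    obtain f where f: "f \<in> PiE I S" "\<forall>j\<in>K. \<not> E j f" using sat[OF K(2,1)] by auto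
    have "f \<in> U" if "U \<in> \<F>" for U
    proof (cases "U = PiE I S")
      case False
      with that have "U \<in> \<F> - {PiE I S}" by simp
      then obtain j where "j \<in> K" "U = C j" unfolding K(3) by (elim imageE)
      with f show ?thesis unfolding C_def by simp
    qed (use f in simp)
    then have "f \<in> \<Inter>\<F>" by blast
    then show "\<Inter>\<F> \<noteq> {}" by blast
  qed
  then show ?thesis by (auto simp: C_def)
qed

text \<open>A finite set of events reads only finitely many coordinates \<open>K\<close>, so it can be avoided by
  counting in the finite set \<open>PiE K S\<close>; compactness passes to all events at once. Two events
  count as dependent if they read a common coordinate.\<close>

theorem local_lemma_PiE:
  fixes S :: "'i \<Rightarrow> 'b set" and E :: "'j \<Rightarrow> ('i \<Rightarrow> 'b) \<Rightarrow> bool" and p :: real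
  assumes S: "\<And>i. i \<in> I \<Longrightarrow> finite (S i) \<and> S i \<noteq> {}"
    and N: "\<And>j. j \<in> J \<Longrightarrow> finite (N j) \<and> N j \<subseteq> I \<and> depends_on (N j) (E j)"
    and prob: "\<And>j. j \<in> J \<Longrightarrow> card {f \<in> PiE (N j) S. E j f} \<le> p * card (PiE (N j) S)"
    and deg: "\<And>j. j \<in> J \<Longrightarrow> finite {i \<in> J. i \<noteq> j \<and> N i \<inter> N j \<noteq> {}} \<and>
      card {i \<in> J. i \<noteq> j \<and> N i \<inter> N j \<noteq> {}} \<le> d"
    and p: "0 \<le> p" and epd: "exp 1 * (real d + 1) * p \<le> 1"
  shows "\<exists>f \<in> PiE I S. \<forall>j\<in>J. \<not> E j f"
proof (rule PiE_compactness[of I S J N])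
  fix F assume F: "finite F" "F \<subseteq> J"
  define K where "K = (\<Union>j\<in>F. N j)"
  have K: "finite K" "K \<subseteq> I" using F N by (auto simp: K_def)
  obtain x where x: "p \<le> x * (1 - x) ^ d" "0 \<le> x" "x < 1"
    using symmetric_weight[OF p epd] by blast
  define \<Gamma> where "\<Gamma> j = {i \<in> J. i \<noteq> j \<and> N i \<inter> N j \<noteq> {}}" for j
  have "PiE K S - (\<Union>j\<in>F. {f. E j f}) \<noteq> {}"
  proof (rule local_lemma[where \<Gamma> = \<Gamma>, OF _ F(1) _ _ _ x])
    show "finite (PiE K S)" using K S by (intro finite_PiE) auto
    show "PiE K S \<noteq> {}" using K S by (auto simp: PiE_eq_empty_iff)
    fix j assume j: "j \<in> F"
    show "card (F \<inter> \<Gamma> j) \<le> d"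
      using deg[of j] j F card_mono[of "\<Gamma> j" "F \<inter> \<Gamma> j"] unfolding \<Gamma>_def
      by (meson Int_lower2 order_trans subsetD)
    fix T assume T: "T \<subseteq> F - insert j (\<Gamma> j)"
    let ?Q = "\<lambda>f. \<forall>i\<in>T. \<not> E i f"
    have Tj: "N i \<inter> N j = {} \<and> i \<in> J \<and> N i \<subseteq> K - N j" if "i \<in> T" for i
      using that T F unfolding \<Gamma>_def K_def by fast
    have Q: "depends_on (K - N j) ?Q"
      unfolding depends_on_def
    proof (intro allI impI)
      fix f g :: "'i \<Rightarrow> 'b" assume eq: "\<forall>i\<in>K - N j. f i = g i"
      have "E i f = E i g" if "i \<in> T" for i
      proof (rule depends_onD[of "N i" "E i"])
        show "depends_on (N i) (E i)" using Tj[OF that] N by blast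
      qed (use Tj[OF that] eq in blast)
      then show "?Q f = ?Q g" by blast
    qed
    have un: "N j \<union> (K - N j) = K" using j by (auto simp: K_def)
    have Ej: "depends_on (N j) (E j)" using N j F by auto
    have tr: "depends_on (N j) (\<lambda>f. True)" by (simp add: depends_on_def)
    have "(PiE K S - (\<Union>j\<in>T. {f. E j f})) \<inter> {f. E j f}
        = {f \<in> PiE (N j \<union> (K - N j)) S. E j f \<and> ?Q f}" unfolding un by auto
    then have "card ((PiE K S - (\<Union>j\<in>T. {f. E j f})) \<inter> {f. E j f})
        = card {f \<in> PiE (N j) S. E j f} * card {f \<in> PiE (K - N j) S. ?Q f}"
      using card_PiE_independent[OF _ Ej Q, of S] by auto
    moreover have "PiE K S - (\<Union>j\<in>T. {f. E j f})
        = {f \<in> PiE (N j \<union> (K - N j)) S. True \<and> ?Q f}" unfolding un by auto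
    then have "card (PiE K S - (\<Union>j\<in>T. {f. E j f}))
        = card (PiE (N j) S) * card {f \<in> PiE (K - N j) S. ?Q f}"
      using card_PiE_independent[OF _ tr Q, of S] by auto
    ultimately show "card ((PiE K S - (\<Union>j\<in>T. {f. E j f})) \<inter> {f. E j f})
        \<le> p * card (PiE K S - (\<Union>j\<in>T. {f. E j f}))"
      using prob[of j] j F
      by (auto simp: mult.assoc[symmetric] intro!: mult_right_mono)
  qed
  then obtain f where f: "f \<in> PiE K S" "\<forall>j\<in>F. \<not> E j f" by blast
  have sel: "(SOME s. s \<in> S i) \<in> S i" if "i \<in> I" for i
    using S[OF that] by (simp add: some_in_eq)
  define g where "g = restrict (\<lambda>i. if i \<in> K then f i else (SOME s. s \<in> S i)) I"
  have "g \<in> PiE I S"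
    using PiE_mem[OF f(1)] sel by (auto simp: g_def)
  moreover have "\<not> E j g" if "j \<in> F" for j
  proof -
    have "E j g = E j f"
    proof (rule depends_onD[of "N j" "E j"])
      show "depends_on (N j) (E j)" using N F that by blast
    qed (use K that in \<open>auto simp: g_def K_def\<close>)
    then show ?thesis using f that by blast
  qed
  ultimately show "\<exists>f\<in>PiE I S. \<forall>j\<in>F. \<not> E j f" by blast
qed (use S N in auto)

section \<open>Cardinality and mean inequalities\<close>

lemma real_card_Diff:
  assumes "finite Z" "M \<subseteq> Z"
  shows "real (card (Z - M)) = real (card Z) - real (card M)"
  using assms by (simp add: card_Diff_subset finite_subset of_nat_diff card_mono)

lemma finite_card_le_subset:
  assumes "M \<subseteq> U" "finite U \<and> card U \<le> n"
  shows "finite M \<and> card M \<le> n"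
  using assms card_mono[of U M] finite_subset[of M U] by simp

lemma card_UN_le_mult:
  assumes "finite I" "card I \<le> n" "\<And>i. i \<in> I \<Longrightarrow> finite (F i) \<and> card (F i) \<le> m"
  shows "finite (\<Union>i\<in>I. F i) \<and> card (\<Union>i\<in>I. F i) \<le> n * m"
proof -
  have "card (\<Union>i\<in>I. F i) \<le> (\<Sum>i\<in>I. card (F i))"
    by (rule card_UN_le[OF assms(1)])
  also have "\<dots> \<le> card I * m"
    using assms(3) sum_bounded_above[of I "\<lambda>i. card (F i)" m] by auto
  also have "\<dots> \<le> n * m" using assms(2) by simp
  finally show ?thesis using assms by auto
qed

text \<open>This is Jensen's inequality for the concave function \<open>t \<mapsto> ln (1 - q powr t)\<close>. AM-GM for the
  factors \<open>1 - q ^ r i\<close> bounds the product by a power of one minus the mean of the \<open>q ^ r i\<close>,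
  and AM-GM for the \<open>q ^ r i\<close> bounds that mean from below.\<close>

lemma prod_one_minus_power_le:
  fixes q R :: real and r :: "'x \<Rightarrow> nat"
  assumes S: "finite S" "S \<noteq> {}" and q: "0 < q" "q < 1"
    and sum: "real (\<Sum>i\<in>S. r i) \<le> R * card S"
  shows "(\<Prod>i\<in>S. 1 - q ^ r i) \<le> (1 - q powr R) ^ card S"
proof -
  define n where "n = card S"
  have n: "n > 0" using S by (simp add: n_def card_gt_0_iff)
  define P where "P = (\<Prod>i\<in>S. 1 - q ^ r i)"
  have le1: "q ^ r i \<le> 1" for i using q by (simp add: power_le_one)
  have P: "0 \<le> P" unfolding P_def using le1 by (intro prod_nonneg) auto
  have "q powr R \<le> q powr (real (\<Sum>i\<in>S. r i) / n)"
    using q sum n by (intro powr_mono') (auto simp: n_def field_simps)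
  also have "\<dots> = (\<Prod>i\<in>S. q ^ r i) powr (1 / n)"
  proof -
    have "(\<Prod>i\<in>S. q ^ r i) = q powr real (\<Sum>i\<in>S. r i)"
      using q by (simp only: power_sum[symmetric] powr_realpow)
    then show ?thesis by (simp add: powr_powr)
  qed
  also have "\<dots> \<le> (\<Sum>i\<in>S. q ^ r i / n)"
    unfolding n_def using S q by (intro arith_geom_mean) auto
  finally have geo: "q powr R \<le> (\<Sum>i\<in>S. q ^ r i / n)" .
  have "P powr (1 / n) \<le> (\<Sum>i\<in>S. (1 - q ^ r i) / n)"
    unfolding n_def P_def using S le1 by (intro arith_geom_mean) auto
  also have "\<dots> = 1 - (\<Sum>i\<in>S. q ^ r i / n)"
    using n by (simp add: diff_divide_distrib sum_subtractf n_def)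
  also have "\<dots> \<le> 1 - q powr R" using geo by simp
  finally have "(P powr (1 / n)) ^ n \<le> (1 - q powr R) ^ n"
    by (intro power_mono) auto
  moreover have "(P powr (1 / n)) ^ n = P"
    using P n by (cases "P = 0") (auto simp: powr_realpow[symmetric] powr_powr)
  ultimately show ?thesis by (simp add: P_def n_def)
qed

lemma powr_inverse_power:
  fixes c :: real
  assumes "0 < c" "0 < n"
  shows "(c powr (1 / real n)) ^ n = c"
  using assms by (simp add: powr_realpow[symmetric] powr_powr)

section \<open>Random choices on one side of a cover\<close>

text \<open>The part of a correspondence-cover that random choices on \<open>B\<close> use: lists of exact sizes
  \<open>k\<close> and \<open>l\<close>, and an adjacency that is a matching between any two lists on opposite sides,
  which is how \<open>match_A\<close> and \<open>match_B\<close> express it.\<close>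

locale list_cover =
  fixes A B :: "'a set" and L :: "'a \<Rightarrow> 'b set" and adj :: "'b \<Rightarrow> 'b \<Rightarrow> bool" and k l :: nat
  assumes size_A: "v \<in> A \<Longrightarrow> finite (L v) \<and> card (L v) = k"
    and size_B: "w \<in> B \<Longrightarrow> finite (L w) \<and> card (L w) = l"
    and k_pos: "1 \<le> k" and l_pos: "1 \<le> l"
    and disjoint_A: "disjoint_family_on L A"
    and match_B: "\<lbrakk>v \<in> A; w \<in> B; x \<in> L v; y \<in> L w; y' \<in> L w; adj x y; adj x y'\<rbrakk> \<Longrightarrow> y = y'"
    and match_A: "\<lbrakk>v \<in> A; w \<in> B; x \<in> L v; x' \<in> L v; y \<in> L w; adj x y; adj x' y\<rbrakk> \<Longrightarrow> x = x'"
begin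

text \<open>A vertex \<open>x\<close> has at most one neighbour in each list \<open>L w\<close>, so these \<open>w\<close> can stand for the
  neighbours of \<open>x\<close>. They are also the coordinates that decide whether \<open>x\<close> is hit.\<close>

definition reach :: "'b \<Rightarrow> 'a set" where
  "reach x = {w \<in> B. \<exists>y\<in>L w. adj x y}"

definition nbrs_A :: "'a \<Rightarrow> 'a set" where
  "nbrs_A v = (\<Union>x\<in>L v. reach x)"

definition nbrs_B :: "'a \<Rightarrow> 'a set" where
  "nbrs_B w = {v \<in> A. w \<in> nbrs_A v}"

definition coreach :: "'b \<Rightarrow> 'b set" where
  "coreach y = {x \<in> \<Union>(L ` A). adj x y}"

definition hit :: "'b \<Rightarrow> ('a \<Rightarrow> 'b) \<Rightarrow> bool" where
  "hit x f \<longleftrightarrow> (\<exists>w\<in>reach x. adj x (f w))"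

text \<open>In the application there are no edges between lists on side \<open>A\<close>, so the unhit vertices can be
  chosen independently of one another.\<close>

definition extendable :: "('a \<Rightarrow> 'b) \<Rightarrow> bool" where
  "extendable f \<longleftrightarrow> (\<forall>v\<in>A. \<exists>x\<in>L v. \<forall>w\<in>B. \<not> adj x (f w))"

lemma L_A_nonempty: "v \<in> A \<Longrightarrow> L v \<noteq> {}"
  using size_A[of v] k_pos by auto

lemma L_B_nonempty: "w \<in> B \<Longrightarrow> L w \<noteq> {}"
  using size_B[of w] l_pos by auto

lemma part_unique: "\<lbrakk>v \<in> A; v' \<in> A; x \<in> L v; x \<in> L v'\<rbrakk> \<Longrightarrow> v = v'"
  using disjoint_A unfolding disjoint_family_on_def by blast

lemma reach_B: "reach x \<subseteq> B"
  by (auto simp: reach_def)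

lemma nbrs_A_B: "nbrs_A v \<subseteq> B"
  using reach_B by (auto simp: nbrs_A_def)

lemma hitI: "f \<in> PiE B L \<Longrightarrow> w \<in> B \<Longrightarrow> adj x (f w) \<Longrightarrow> hit x f"
  by (auto simp: hit_def reach_def)

lemma extendableI:
  assumes "f \<in> PiE B L" "\<And>v. v \<in> A \<Longrightarrow> \<exists>x\<in>L v. \<not> hit x f"
  shows "extendable f"
  unfolding extendable_def using assms hitI by blast

lemma reach_subset_nbrs_A: "x \<in> L v \<Longrightarrow> reach x \<subseteq> nbrs_A v"
  by (auto simp: nbrs_A_def)

lemma card_nbrs_A_le:
  assumes "v \<in> A" "\<And>x. x \<in> L v \<Longrightarrow> finite (reach x) \<and> card (reach x) \<le> D"
  shows "finite (nbrs_A v) \<and> card (nbrs_A v) \<le> k * D"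
  unfolding nbrs_A_def using size_A[OF assms(1)] assms(2)
  by (intro card_UN_le_mult) auto

lemma card_nbrs_B_le:
  assumes w: "w \<in> B" and coreach: "\<And>y. y \<in> L w \<Longrightarrow> finite (coreach y) \<and> card (coreach y) \<le> D"
  shows "finite (nbrs_B w) \<and> card (nbrs_B w) \<le> l * D"
proof -
  have parts: "finite {v \<in> A. x \<in> L v} \<and> card {v \<in> A. x \<in> L v} \<le> 1" for x
  proof (cases "\<exists>v\<in>A. x \<in> L v")
    case True
    then obtain v where "v \<in> A" "x \<in> L v" by blast
    then have "{v \<in> A. x \<in> L v} = {v}" using part_unique by blast
    then show ?thesis by simp
  next
    case False
    then have empty: "{v \<in> A. x \<in> L v} = {}" by blast
    show ?thesis unfolding empty by simp
  qed
  let ?U = "\<Union>y\<in>L w. \<Union>x\<in>coreach y. {v \<in> A. x \<in> L v}"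
  have "finite ?U \<and> card ?U \<le> l * (D * 1)"
    using size_B[OF w] coreach parts by (intro card_UN_le_mult) auto
  moreover have "nbrs_B w \<subseteq> ?U"
    by (auto simp: nbrs_B_def nbrs_A_def reach_def coreach_def)
  ultimately show ?thesis
    using finite_card_le_subset[of "nbrs_B w" ?U "l * (D * 1)"] by simp
qed

text \<open>Double counting: the matching between \<open>L v\<close> and \<open>L w\<close> has at most \<open>min k l\<close> edges.\<close>

lemma sum_card_reach_le:
  assumes v: "v \<in> A" and fin: "finite (nbrs_A v)"
  shows "(\<Sum>x\<in>L v. card (reach x)) \<le> card (nbrs_A v) * min k l"
proof -
  have edges: "card {x \<in> L v. w \<in> reach x} \<le> min k l" if w: "w \<in> B" for w
  proof -
    define m where "m x = (SOME y. y \<in> L w \<and> adj x y)" for x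
    have m: "m x \<in> L w \<and> adj x (m x)" if "w \<in> reach x" for x
      unfolding m_def by (rule someI_ex) (use that in \<open>auto simp: reach_def\<close>)
    have "inj_on m {x \<in> L v. w \<in> reach x}"
    proof (rule inj_onI)
      fix x x' assume x: "x \<in> {x \<in> L v. w \<in> reach x}" "x' \<in> {x \<in> L v. w \<in> reach x}" "m x = m x'"
      then show "x = x'" using m[of x] m[of x'] match_A[OF v w, of x x' "m x"] by auto
    qed
    moreover have "m ` {x \<in> L v. w \<in> reach x} \<subseteq> L w" using m by auto
    ultimately have "card {x \<in> L v. w \<in> reach x} \<le> l"
      using size_B[OF w] card_inj_on_le by metis
    moreover have "card {x \<in> L v. w \<in> reach x} \<le> k"
      using size_A[OF v] card_mono[of "L v" "{x \<in> L v. w \<in> reach x}"] by auto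
    ultimately show ?thesis by simp
  qed
  have "(\<Sum>x\<in>L v. card (reach x)) = (\<Sum>x\<in>L v. \<Sum>w\<in>nbrs_A v. if w \<in> reach x then 1 else 0)"
  proof (rule sum.cong)
    fix x assume "x \<in> L v"
    then have "nbrs_A v \<inter> {w. w \<in> reach x} = reach x" using reach_subset_nbrs_A by blast
    then show "card (reach x) = (\<Sum>w\<in>nbrs_A v. if w \<in> reach x then 1 else 0)"
      using fin by (simp add: sum.If_cases)
  qed simp
  also have "\<dots> = (\<Sum>w\<in>nbrs_A v. \<Sum>x\<in>L v. if w \<in> reach x then 1 else 0)"
    by (rule sum.swap)
  also have "\<dots> = (\<Sum>w\<in>nbrs_A v. card {x \<in> L v. w \<in> reach x})"
    using size_A[OF v] by (intro sum.cong) (auto simp: sum.If_cases Int_def)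
  also have "\<dots> \<le> card (nbrs_A v) * min k l"
    using edges nbrs_A_B sum_bounded_above[of "nbrs_A v" "\<lambda>w. card {x \<in> L v. w \<in> reach x}" "min k l"]
    by auto
  finally show ?thesis .
qed

text \<open>Conditioned on all of \<open>X\<close> being hit, the probability that no choice in \<open>R\<close> hits \<open>x\<close> is at
  least what it would be without the condition. The lists in \<open>R\<close> are treated one by one. If the
  choice at \<open>w\<close> hits \<open>x\<close>, it hits nothing else in \<open>L v\<close>; replacing it by any of the \<open>l\<close>
  vertices of \<open>L w\<close> keeps \<open>X\<close> hit. This switching shows that at most one in \<open>l\<close> of the surviving
  choices hits \<open>x\<close> at \<open>w\<close>.\<close>

lemma card_avoid_ge:
  fixes v x X
  defines "Z \<equiv> \<lambda>R. {f \<in> PiE (nbrs_A v) L. (\<forall>x'\<in>X. hit x' f) \<and> (\<forall>w\<in>R. \<not> adj x (f w))}"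
  assumes v: "v \<in> A" and fin: "finite (nbrs_A v)" and x: "x \<in> L v" and X: "X \<subseteq> L v - {x}"
    and R: "finite R" "R \<subseteq> reach x"
  shows "(1 - 1 / real l) ^ card R * card (Z {}) \<le> card (Z R)"
  using R
proof (induction R)
  case (insert w R)
  let ?N = "nbrs_A v"
  have N: "w \<in> ?N" using insert x by (auto simp: nbrs_A_def)
  have w: "w \<in> B" using N nbrs_A_B by blast
  have finZ: "finite (Z R)" for R
    unfolding Z_def
    by (rule finite_subset[of _ "PiE ?N L"])
      (use fin size_B nbrs_A_B in \<open>auto intro!: finite_PiE\<close>)
  define W where "W = {f \<in> Z R. adj x (f w)}"
  have W_mem: "f w \<in> L w" "adj x (f w)" if "f \<in> W" for f
    using that N by (auto simp: W_def Z_def)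
  have "inj_on (\<lambda>(f, y). f(w := y)) (W \<times> L w)"
  proof (rule inj_onI, clarify)
    fix f y g z assume f: "f \<in> W" "g \<in> W" and eq: "f(w := y) = g(w := z)"
    have "f w = g w"
      using match_B[OF v w x] W_mem[OF f(1)] W_mem[OF f(2)] by blast
    then have "f = g" using eq by (metis fun_upd_triv fun_upd_upd)
    moreover have "y = z" using eq by (metis fun_upd_same)
    ultimately show "f = g \<and> y = z" by blast
  qed
  moreover have "(\<lambda>(f, y). f(w := y)) ` (W \<times> L w) \<subseteq> Z R"
  proof clarify
    fix f y assume f: "f \<in> W" and y: "y \<in> L w"
    have "f(w := y) \<in> PiE ?N L"
      using f y N by (auto simp: W_def Z_def PiE_iff extensional_def)
    moreover have "hit x' (f(w := y))" if x': "x' \<in> X" for x'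
    proof -
      obtain w' where w': "w' \<in> reach x'" "adj x' (f w')"
        using f x' by (auto simp: W_def Z_def hit_def)
      have "w' \<noteq> w"
        using match_A[OF v w x, of x' "f w"] W_mem[OF f] w'(2) x' X by auto
      then show ?thesis using w' by (auto simp: hit_def)
    qed
    ultimately show "f(w := y) \<in> Z R"
      using f insert.hyps by (auto simp: W_def Z_def)
  qed
  ultimately have "card (W \<times> L w) \<le> card (Z R)"
    using finZ card_inj_on_le by blast
  then have W_le: "real (card W) * l \<le> card (Z R)"
    using size_B[OF w] by (simp add: card_cartesian_product flip: of_nat_mult)
  have "Z (insert w R) = Z R - W" by (auto simp: Z_def W_def)
  moreover have "W \<subseteq> Z R" by (auto simp: W_def)
  ultimately have "real (card (Z (insert w R))) = card (Z R) - real (card W)"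
    using finZ by (simp add: real_card_Diff)
  moreover have "real (card W) \<le> card (Z R) / l"
    using W_le l_pos by (simp add: field_simps)
  ultimately have "(1 - 1 / real l) * card (Z R) \<le> card (Z (insert w R))"
    by (simp add: algebra_simps)
  moreover have "(1 - 1 / real l) ^ card (insert w R) * card (Z {}) \<le> (1 - 1 / real l) * card (Z R)"
    using insert l_pos by (auto simp: mult.assoc intro!: mult_left_mono)
  ultimately show ?case by linarith
qed simp

text \<open>The vertices of \<open>X\<close> are added one at a time, and \<open>card_avoid_ge\<close> with \<open>R = reach x\<close> bounds
  each conditional probability of a hit.\<close>

lemma card_all_hit_le:
  assumes v: "v \<in> A" and fin: "finite (nbrs_A v)" and X: "X \<subseteq> L v"
  shows "card {f \<in> PiE (nbrs_A v) L. \<forall>x\<in>X. hit x f}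
    \<le> (\<Prod>x\<in>X. 1 - (1 - 1 / real l) ^ card (reach x)) * card (PiE (nbrs_A v) L)"
proof -
  have finX: "finite X" using X size_A[OF v] finite_subset by blast
  from finX X show ?thesis
  proof (induction X)
    case (insert x X)
    let ?\<Omega> = "PiE (nbrs_A v) L" and ?q = "1 - (1 - 1 / real l) ^ card (reach x)"
    have x: "x \<in> L v" using insert by blast
    have fr: "finite (reach x)"
      using fin finite_subset[OF reach_subset_nbrs_A[OF x]] by blast
    have fin\<Omega>: "finite ?\<Omega>"
      using fin size_B nbrs_A_B by (intro finite_PiE) auto
    have q0: "0 \<le> ?q" using l_pos by (simp add: power_le_one)
    let ?Z = "{f \<in> ?\<Omega>. \<forall>x\<in>X. hit x f}"
    let ?M = "{f \<in> ?\<Omega>. (\<forall>x\<in>X. hit x f) \<and> (\<forall>w\<in>reach x. \<not> adj x (f w))}"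
    have miss: "(1 - 1 / real l) ^ card (reach x) * card ?Z \<le> card ?M"
      using card_avoid_ge[OF v fin x _ fr, of X] insert by auto
    have "{f \<in> ?\<Omega>. \<forall>x'\<in>insert x X. hit x' f} = ?Z - ?M"
      by (auto simp: hit_def)
    moreover have "finite ?Z" "?M \<subseteq> ?Z" using fin\<Omega> by auto
    ultimately have "real (card {f \<in> ?\<Omega>. \<forall>x'\<in>insert x X. hit x' f}) = card ?Z - real (card ?M)"
      using real_card_Diff by simp
    also have "\<dots> \<le> ?q * card ?Z"
      using miss by (simp add: algebra_simps)
    also have "\<dots> \<le> ?q * ((\<Prod>x\<in>X. 1 - (1 - 1 / real l) ^ card (reach x)) * card ?\<Omega>)"
      using insert q0 by (intro mult_left_mono) auto
    finally show ?case using insert by (simp add: mult.assoc)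
  qed simp
qed

text \<open>The bad events at \<open>v\<close> and \<open>v'\<close> are dependent only if \<open>v\<close> and \<open>v'\<close> have a common neighbour.
  There are at most \<open>a\<close> neighbours \<open>w\<close> of \<open>v\<close>, and each has at most \<open>b - 1\<close> neighbours besides \<open>v\<close>.\<close>

theorem extendable_if_hit_prob_small:
  assumes degA: "\<And>v. v \<in> A \<Longrightarrow> finite (nbrs_A v) \<and> card (nbrs_A v) \<le> a"
    and degB: "\<And>w. w \<in> B \<Longrightarrow> finite (nbrs_B w) \<and> card (nbrs_B w) \<le> b" and b: "1 \<le> b"
    and prob: "\<And>v. v \<in> A \<Longrightarrow> (\<Prod>x\<in>L v. 1 - (1 - 1 / real l) ^ card (reach x)) \<le> p"
    and p: "0 \<le> p" and e: "exp 1 * (real a * (real b - 1) + 1) * p \<le> 1"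
  shows "\<exists>f \<in> PiE B L. extendable f"
proof -
  have "\<exists>f\<in>PiE B L. \<forall>v\<in>A. \<not> (\<forall>x\<in>L v. hit x f)"
  proof (rule local_lemma_PiE[of B L A nbrs_A])
    show "finite (L w) \<and> L w \<noteq> {}" if "w \<in> B" for w
      using size_B[OF that] L_B_nonempty[OF that] by blast
    show "finite (nbrs_A v) \<and> nbrs_A v \<subseteq> B \<and> depends_on (nbrs_A v) (\<lambda>f. \<forall>x\<in>L v. hit x f)"
      if "v \<in> A" for v
    proof (intro conjI)
      show "depends_on (nbrs_A v) (\<lambda>f. \<forall>x\<in>L v. hit x f)"
        unfolding depends_on_def nbrs_A_def hit_def by simp
    qed (use degA[OF that] nbrs_A_B in auto)
    show "real (card {f \<in> PiE (nbrs_A v) L. \<forall>x\<in>L v. hit x f}) \<le> p * card (PiE (nbrs_A v) L)"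
      if "v \<in> A" for v
      using card_all_hit_le[OF that _ order_refl] degA[OF that] prob[OF that]
      by (meson mult_right_mono of_nat_0_le_iff order_trans)
    show "finite {i \<in> A. i \<noteq> v \<and> nbrs_A i \<inter> nbrs_A v \<noteq> {}} \<and>
        card {i \<in> A. i \<noteq> v \<and> nbrs_A i \<inter> nbrs_A v \<noteq> {}} \<le> a * (b - 1)" if v: "v \<in> A" for v
    proof -
      let ?U = "\<Union>w\<in>nbrs_A v. nbrs_B w - {v}"
      have "finite ?U \<and> card ?U \<le> a * (b - 1)"
      proof (rule card_UN_le_mult)
        fix w assume w: "w \<in> nbrs_A v"
        then have "v \<in> nbrs_B w" "w \<in> B" using v nbrs_A_B by (auto simp: nbrs_B_def)
        then show "finite (nbrs_B w - {v}) \<and> card (nbrs_B w - {v}) \<le> b - 1"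
          using degB[of w] by (auto simp: card_Diff_singleton)
      qed (use degA[OF v] in auto)
      moreover have "{i \<in> A. i \<noteq> v \<and> nbrs_A i \<inter> nbrs_A v \<noteq> {}} \<subseteq> ?U"
        by (auto simp: nbrs_B_def)
      ultimately show ?thesis by (rule finite_card_le_subset[rotated])
    qed
    show "0 \<le> p" by fact
    show "exp 1 * (real (a * (b - 1)) + 1) * p \<le> 1"
      using e b by (simp add: of_nat_diff)
  qed
  then show ?thesis using extendableI by blast
qed

text \<open>A witness \<open>(v, \<omega>)\<close> proposes that each \<open>x \<in> L v\<close> is hit at \<open>\<omega> x\<close>. Injectivity loses nothing,
  as one choice cannot hit two vertices of \<open>L v\<close>; it makes the \<open>k\<close> hits independent.\<close>

definition witnesses :: "('a \<times> ('b \<Rightarrow> 'a)) set" where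
  "witnesses = (SIGMA v:A. {\<omega> \<in> PiE (L v) reach. inj_on \<omega> (L v)})"

text \<open>The vertex \<open>x\<close> determines \<open>v\<close>, the value of \<open>\<omega>\<close> at \<open>x\<close> is prescribed, and each of the
  other \<open>k - 1\<close> values is one of at most \<open>D\<close> lists.\<close>

lemma card_witnesses_through_le:
  assumes degA: "\<And>v x. v \<in> A \<Longrightarrow> x \<in> L v \<Longrightarrow> finite (reach x) \<and> card (reach x) \<le> D"
  shows "finite {(v, \<omega>) \<in> witnesses. x \<in> L v \<and> \<omega> x = w} \<and>
    card {(v, \<omega>) \<in> witnesses. x \<in> L v \<and> \<omega> x = w} \<le> D ^ (k - 1)" (is "finite ?F \<and> card ?F \<le> _")
proof (cases "\<exists>v\<in>A. x \<in> L v")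
  case False
  then have "?F = {}" by (auto simp: witnesses_def)
  then show ?thesis by (metis card.empty finite.emptyI le0)
next
  case True
  then obtain v where v: "v \<in> A" "x \<in> L v" by blast
  let ?P = "PiE (L v) (\<lambda>z. if z = x then {w} else reach z)"
  have L: "finite (L v)" "card (L v) = k" using size_A v by auto
  have fin: "finite ?P" using L degA v by (intro finite_PiE) auto
  have "card ?P = (\<Prod>z\<in>L v. card (if z = x then {w} else reach z))"
    using L by (simp add: card_PiE)
  also have "\<dots> \<le> (\<Prod>z\<in>L v. if z = x then 1 else D)"
    using degA v by (intro prod_mono) auto
  also have "\<dots> = D ^ (k - 1)"
    using L v by (simp add: prod.remove[of "L v" x] card_Diff_singleton)
  finally have card: "card ?P \<le> D ^ (k - 1)" .
  have sub: "?F \<subseteq> Pair v ` ?P"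
  proof
    fix j assume "j \<in> ?F"
    then obtain v' \<omega> where j: "j = (v', \<omega>)" "v' \<in> A" "x \<in> L v'" "\<omega> \<in> PiE (L v') reach" "\<omega> x = w"
      by (auto simp: witnesses_def)
    have "v' = v" using part_unique j v by blast
    with j show "j \<in> Pair v ` ?P" by (auto simp: PiE_iff)
  qed
  show ?thesis
    using fin card card_image_le[OF fin, of "Pair v"] by (intro finite_card_le_subset[OF sub]) auto
qed

text \<open>A witness that shares a list with \<open>(v, \<omega>)\<close> is reached by picking \<open>x \<in> L v\<close>, a vertex \<open>y\<close> of
  \<open>L (\<omega> x)\<close>, a neighbour \<open>x'\<close> of \<open>y\<close> and a witness that sends \<open>x'\<close> to \<open>\<omega> x\<close>. This gives at most
  \<open>k * l * D' * D ^ (k - 1)\<close> witnesses, among them \<open>(v, \<omega>)\<close> itself.\<close>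

theorem extendable_if_few_witnesses:
  assumes degA: "\<And>v x. v \<in> A \<Longrightarrow> x \<in> L v \<Longrightarrow> finite (reach x) \<and> card (reach x) \<le> D"
    and degB: "\<And>w y. w \<in> B \<Longrightarrow> y \<in> L w \<Longrightarrow> finite (coreach y) \<and> card (coreach y) \<le> D'"
    and D: "1 \<le> D" "1 \<le> D'"
    and e: "exp 1 * real (k * (l * (D' * D ^ (k - 1)))) \<le> real l ^ k"
  shows "\<exists>f \<in> PiE B L. extendable f"
proof -
  define M where "M = k * (l * (D' * D ^ (k - 1)))"
  have M: "M \<ge> 1" using D k_pos l_pos by (simp add: M_def Suc_le_eq)
  define N where "N = (\<lambda>(v, \<omega> :: 'b \<Rightarrow> 'a). \<omega> ` L v)"
  define E where "E = (\<lambda>(v, \<omega> :: 'b \<Rightarrow> 'a) f. \<forall>x\<in>L v. adj x (f (\<omega> x)))"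
  have "\<exists>f\<in>PiE B L. \<forall>j\<in>witnesses. \<not> E j f"
  proof (rule local_lemma_PiE[of B L witnesses N])
    show "finite (L w) \<and> L w \<noteq> {}" if "w \<in> B" for w
      using size_B[OF that] L_B_nonempty[OF that] by blast
    fix j assume "j \<in> witnesses"
    then obtain v \<omega> where j: "j = (v, \<omega>)" "v \<in> A" "\<omega> \<in> PiE (L v) reach" "inj_on \<omega> (L v)"
      by (auto simp: witnesses_def)
    have L: "finite (L v)" "card (L v) = k" using size_A j by auto
    have \<omega>B: "\<omega> x \<in> B" if "x \<in> L v" for x
      using that j(3) reach_B by blast
    show "finite (N j) \<and> N j \<subseteq> B \<and> depends_on (N j) (E j)"
      using L \<omega>B j(1) by (auto simp: N_def E_def depends_on_def)
    \<comment> \<open>the event prescribes every coordinate that it reads: \<open>x\<close> has one neighbour in \<open>L (\<omega> x)\<close>\<close>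
    have "f = g" if f: "f \<in> PiE (N j) L" "E j f" and g: "g \<in> PiE (N j) L" "E j g" for f g
    proof (rule PiE_ext[OF f(1) g(1)])
      fix w assume "w \<in> N j"
      then obtain x where x: "x \<in> L v" "w = \<omega> x" by (auto simp: N_def j(1))
      have "f w \<in> L w" "g w \<in> L w" using f g \<open>w \<in> N j\<close> by auto
      moreover have "adj x (f w)" "adj x (g w)" using f g x by (auto simp: E_def j(1))
      ultimately show "f w = g w" using match_B[OF j(2) \<omega>B[OF x(1)] x(1)] x(2) by blast
    qed
    then have "card {f \<in> PiE (N j) L. E j f} \<le> 1"
      by (cases "finite {f \<in> PiE (N j) L. E j f}") (auto simp: card_le_Suc0_iff_eq)
    moreover have "card (PiE (N j) L) = l ^ k"
    proof -
      have "card (PiE (N j) L) = (\<Prod>w\<in>N j. card (L w))"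
        using L by (intro card_PiE) (auto simp: N_def j(1))
      also have "\<dots> = (\<Prod>w\<in>N j. l)"
        using size_B \<omega>B by (intro prod.cong) (auto simp: N_def j(1))
      also have "\<dots> = l ^ k" using j L by (simp add: N_def card_image)
      finally show ?thesis .
    qed
    ultimately show "real (card {f \<in> PiE (N j) L. E j f}) \<le> 1 / real l ^ k * card (PiE (N j) L)"
      using l_pos by simp
    let ?U = "\<Union>x\<in>L v. \<Union>y\<in>L (\<omega> x). \<Union>x'\<in>coreach y. {(v', \<omega>') \<in> witnesses. x' \<in> L v' \<and> \<omega>' x' = \<omega> x}"
    have U: "finite ?U \<and> card ?U \<le> M"
      unfolding M_def
      using L size_B \<omega>B degB card_witnesses_through_le[OF degA]
      by (intro card_UN_le_mult) auto
    have sub: "{i \<in> witnesses. N i \<inter> N j \<noteq> {}} \<subseteq> ?U"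
    proof
      fix i assume i: "i \<in> {i \<in> witnesses. N i \<inter> N j \<noteq> {}}"
      obtain v' \<omega>' where i': "i = (v', \<omega>')" by (cases i)
      then obtain x x' where x: "x \<in> L v" "x' \<in> L v'" "\<omega>' x' = \<omega> x"
        using i by (force simp: N_def j(1))
      have v': "v' \<in> A" "\<omega>' \<in> PiE (L v') reach" using i i' by (auto simp: witnesses_def)
      then have "\<omega> x \<in> reach x'" using x by (metis PiE_mem)
      then obtain y where "y \<in> L (\<omega> x)" "x' \<in> coreach y"
        using x v' by (auto simp: reach_def coreach_def)
      then show "i \<in> ?U" using x i i' by blast
    qed
    let ?C = "{i \<in> witnesses. N i \<inter> N j \<noteq> {}}"
    have C: "finite ?C" "card ?C \<le> M"
      using finite_card_le_subset[OF sub U] by auto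
    have "j \<in> ?C"
      using \<open>j \<in> witnesses\<close> L_A_nonempty[OF j(2)] by (auto simp: N_def j(1))
    moreover have "{i \<in> witnesses. i \<noteq> j \<and> N i \<inter> N j \<noteq> {}} = ?C - {j}" by auto
    ultimately show "finite {i \<in> witnesses. i \<noteq> j \<and> N i \<inter> N j \<noteq> {}} \<and>
        card {i \<in> witnesses. i \<noteq> j \<and> N i \<inter> N j \<noteq> {}} \<le> M - 1"
      using C by (simp add: card_Diff_singleton)
  next
    show "exp 1 * (real (M - 1) + 1) * (1 / real l ^ k) \<le> 1"
    proof -
      have "exp 1 * real M \<le> real l ^ k" using e by (simp only: M_def)
      then show ?thesis using M l_pos by (simp add: of_nat_diff)
    qed
  qed simp
  then obtain f where f: "f \<in> PiE B L" "\<And>j. j \<in> witnesses \<Longrightarrow> \<not> E j f" by blast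
  have "extendable f"
  proof (rule extendableI[OF f(1)], rule ccontr)
    fix v assume v: "v \<in> A" and "\<not> (\<exists>x\<in>L v. \<not> hit x f)"
    then have "\<forall>x\<in>L v. \<exists>w. w \<in> reach x \<and> adj x (f w)" by (auto simp: hit_def)
    then obtain h where h: "\<And>x. x \<in> L v \<Longrightarrow> h x \<in> reach x \<and> adj x (f (h x))" by metis
    define \<omega> where "\<omega> = restrict h (L v)"
    have "inj_on \<omega> (L v)"
    proof (rule inj_onI)
      fix x x' assume x: "x \<in> L v" "x' \<in> L v" "\<omega> x = \<omega> x'"
      have B: "h x \<in> B" using h x reach_B by blast
      have "f (h x) \<in> L (h x)" using f(1) B by auto
      then show "x = x'"
        using match_A[OF v B x(1,2)] h[OF x(1)] h[OF x(2)] x by (auto simp: \<omega>_def)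
    qed
    then have "(v, \<omega>) \<in> witnesses"
      using v h by (auto simp: witnesses_def \<omega>_def)
    moreover have "E (v, \<omega>) f" using h by (auto simp: E_def \<omega>_def)
    ultimately show False using f(2) by blast
  qed
  with f(1) show ?thesis by blast
qed

section \<open>Sufficient conditions for an extendable choice\<close>


lemma extendable_if_no_edges:
  assumes "\<And>v x. v \<in> A \<Longrightarrow> x \<in> L v \<Longrightarrow> reach x = {}"
  shows "\<exists>f \<in> PiE B L. extendable f"
proof -
  have "PiE B L \<noteq> {}" using L_B_nonempty by (auto simp: PiE_eq_empty_iff)
  then obtain f where f: "f \<in> PiE B L" by blast
  have "extendable f"
  proof (rule extendableI[OF f])
    fix v assume v: "v \<in> A"
    then obtain x where "x \<in> L v" using L_A_nonempty by blast
    with assms v show "\<exists>x\<in>L v. \<not> hit x f" by (auto simp: hit_def)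
  qed
  with f show ?thesis by blast
qed

text \<open>Raised to the power \<open>k - 1\<close> and multiplied by \<open>l\<close>, the hypothesis is the local lemma
  condition for witnesses. If a degree bound is 0 there are no edges at all.\<close>

lemma extendable_if_list_size_large:
  assumes degA: "\<And>v x. v \<in> A \<Longrightarrow> x \<in> L v \<Longrightarrow> finite (reach x) \<and> card (reach x) \<le> D"
    and degB: "\<And>w y. w \<in> B \<Longrightarrow> y \<in> L w \<Longrightarrow> finite (coreach y) \<and> card (coreach y) \<le> D'"
    and k2: "2 \<le> k" and large: "(exp 1 * real k * real D') powr (1 / (real k - 1)) * real D \<le> real l"
  shows "\<exists>f \<in> PiE B L. extendable f"
proof (cases "D = 0 \<or> D' = 0")
  case True
  then show ?thesis
  proof
    assume "D = 0"
    then have "reach x = {}" if "v \<in> A" "x \<in> L v" for v x using degA[OF that] by auto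
    then show ?thesis by (rule extendable_if_no_edges)
  next
    assume "D' = 0"
    then have "coreach y = {}" if "w \<in> B" "y \<in> L w" for w y using degB[OF that] by auto
    then show ?thesis by (intro extendable_if_no_edges) (force simp: reach_def coreach_def)
  qed
next
  case False
  let ?c = "exp 1 * real k * real D'"
  have c: "?c > 0" using False k2 by simp
  have k1: "real (k - 1) = real k - 1" using k2 by (simp add: of_nat_diff)
  have "(?c powr (1 / (real k - 1))) ^ (k - 1) = ?c"
    using powr_inverse_power[OF c, of "k - 1"] k2 by (simp only: k1)
  then have "?c * real D ^ (k - 1) = (?c powr (1 / (real k - 1)) * real D) ^ (k - 1)"
    by (simp add: power_mult_distrib)
  also have "\<dots> \<le> real l ^ (k - 1)"
    using large by (intro power_mono) auto
  finally have "real l * (?c * real D ^ (k - 1)) \<le> real l * real l ^ (k - 1)"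
    by (intro mult_left_mono) auto
  also have "\<dots> = real l ^ k"
    using k2 by (simp flip: power_Suc)
  finally have "exp 1 * real (k * (l * (D' * D ^ (k - 1)))) \<le> real l ^ k"
    by (simp add: algebra_simps)
  then show ?thesis
    using False degA degB by (intro extendable_if_few_witnesses[of D D']) auto
qed

lemma one_minus_power_l_nonneg: "0 \<le> 1 - (1 - 1 / real l) ^ n"
  using l_pos by (simp add: power_le_one)

lemma extendable_if_cover_degrees_small:
  assumes degA: "\<And>v x. v \<in> A \<Longrightarrow> x \<in> L v \<Longrightarrow> finite (reach x) \<and> card (reach x) \<le> D"
    and degB: "\<And>w y. w \<in> B \<Longrightarrow> y \<in> L w \<Longrightarrow> finite (coreach y) \<and> card (coreach y) \<le> D'"
    and e: "exp 1 * (real k * real D * (real l * real D' - 1) + 1)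
      * (1 - (1 - 1 / real l) ^ D) ^ k \<le> 1"
  shows "\<exists>f \<in> PiE B L. extendable f"
proof (cases "D' = 0")
  case True
  then have "coreach y = {}" if "w \<in> B" "y \<in> L w" for w y using degB[OF that] by auto
  then show ?thesis by (intro extendable_if_no_edges) (force simp: reach_def coreach_def)
next
  case False
  show ?thesis
  proof (rule extendable_if_hit_prob_small)
    show "finite (nbrs_A v) \<and> card (nbrs_A v) \<le> k * D" if "v \<in> A" for v
      using that degA by (intro card_nbrs_A_le) auto
    show "finite (nbrs_B w) \<and> card (nbrs_B w) \<le> l * D'" if "w \<in> B" for w
      using that degB by (intro card_nbrs_B_le) auto
    show "1 \<le> l * D'" using False l_pos by (simp add: Suc_le_eq)
    show "0 \<le> (1 - (1 - 1 / real l) ^ D) ^ k" using one_minus_power_l_nonneg by simp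
    show "(\<Prod>x\<in>L v. 1 - (1 - 1 / real l) ^ card (reach x)) \<le> (1 - (1 - 1 / real l) ^ D) ^ k"
      if v: "v \<in> A" for v
    proof -
      have "(\<Prod>x\<in>L v. 1 - (1 - 1 / real l) ^ card (reach x)) \<le> (\<Prod>x\<in>L v. 1 - (1 - 1 / real l) ^ D)"
        using degA[OF v] one_minus_power_l_nonneg l_pos
        by (intro prod_mono) (auto intro!: power_decreasing)
      then show ?thesis using size_A[OF v] by simp
    qed
    show "exp 1 * (real (k * D) * (real (l * D') - 1) + 1) * (1 - (1 - 1 / real l) ^ D) ^ k \<le> 1"
      using e by simp
  qed
qed

text \<open>The mean of \<open>card (reach x)\<close> over \<open>L v\<close> is at most \<open>a * min k l / k\<close>, the exponent in the
  hypothesis. The hypothesis rules out \<open>l = 1\<close> as soon as both degree bounds are positive: the power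
  would then be 0 and the left-hand side at least \<open>exp 1\<close>.\<close>

lemma extendable_if_base_degrees_small:
  assumes degA: "\<And>v. v \<in> A \<Longrightarrow> finite (nbrs_A v) \<and> card (nbrs_A v) \<le> a"
    and degB: "\<And>w. w \<in> B \<Longrightarrow> finite (nbrs_B w) \<and> card (nbrs_B w) \<le> b"
    and e: "exp 1 * (real a * (real b - 1) + 1)
      * (1 - rpow (1 - 1 / real l) (real a * min 1 (real l / real k))) ^ k \<le> 1"
  shows "\<exists>f \<in> PiE B L. extendable f"
proof (cases "a = 0 \<or> b = 0")
  case True
  then show ?thesis
  proof
    assume "a = 0"
    then have "nbrs_A v = {}" if "v \<in> A" for v using degA[OF that] by auto
    then show ?thesis using reach_subset_nbrs_A by (intro extendable_if_no_edges) blast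
  next
    assume "b = 0"
    then have "nbrs_B w = {}" if "w \<in> B" for w using degB[OF that] by auto
    then show ?thesis
      using reach_subset_nbrs_A reach_B by (intro extendable_if_no_edges) (fastforce simp: nbrs_B_def)
  qed
next
  case False
  define R where "R = real a * min 1 (real l / real k)"
  let ?q = "1 - 1 / real l"
  have R: "R > 0" using False k_pos l_pos by (simp add: R_def)
  have "l \<noteq> 1"
  proof
    assume "l = 1"
    with R have "rpow ?q R = 0" by (simp add: rpow_def)
    then have "exp 1 * (real a * (real b - 1) + 1) \<le> 1" using e by (simp add: R_def)
    moreover have "1 * 1 \<le> exp 1 * (real a * (real b - 1) + 1)"
      using False by (intro mult_mono) auto
    moreover have "1 < exp (1::real)" by simp
    moreover have "exp 1 * 1 \<le> exp 1 * (real a * (real b - 1) + 1)"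
      using False by (intro mult_left_mono) auto
    ultimately show False by linarith
  qed
  then have q: "0 < ?q" "?q < 1" using l_pos by auto
  show ?thesis
  proof (rule extendable_if_hit_prob_small[of a b])
    show "1 \<le> b" using False by simp
    show "(\<Prod>x\<in>L v. 1 - ?q ^ card (reach x)) \<le> (1 - ?q powr R) ^ k" if v: "v \<in> A" for v
    proof -
      have "(\<Sum>x\<in>L v. card (reach x)) \<le> card (nbrs_A v) * min k l"
        using v degA by (intro sum_card_reach_le) auto
      also have "\<dots> \<le> a * min k l" using degA[OF v] by simp
      finally have "real (\<Sum>x\<in>L v. card (reach x)) \<le> real (a * min k l)"
        by (rule of_nat_mono)
      also have "\<dots> = R * k"
        using k_pos by (auto simp: R_def min_def field_simps)
      finally show ?thesis
        using prod_one_minus_power_le[of "L v" ?q "\<lambda>x. card (reach x)" R]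
          size_A[OF v] L_A_nonempty[OF v] q by simp
    qed
    show "0 \<le> (1 - ?q powr R) ^ k"
      using q R by (intro zero_le_power) (simp add: powr_le1)
    show "exp 1 * (real a * (real b - 1) + 1) * (1 - ?q powr R) ^ k \<le> 1"
    proof -
      have "rpow ?q R = ?q powr R" using R by (simp add: rpow_def)
      then show ?thesis using e by (simp only: R_def[symmetric])
    qed
  qed (use degA degB in auto)
qed

end

section \<open>Independent transversals\<close>

lemma degree_le_max_degree:
  assumes "max_degree G S = enat d" "v \<in> S"
  shows "finite (neighbours G v) \<and> card (neighbours G v) \<le> d"
proof -
  have "ecard (neighbours G v) \<le> enat d"
    unfolding assms(1)[symmetric] max_degree_def using assms(2) by (rule SUP_upper)
  then show ?thesis by (auto simp: ecard_def split: if_splits)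
qed

lemma subset_with_card_le_ecard:
  assumes "enat k \<le> ecard S"
  obtains T where "T \<subseteq> S" "finite T" "card T = k"
proof (cases "finite S")
  case True
  then have "k \<le> card S" using assms by (simp add: ecard_def)
  then show ?thesis using that obtain_subset_with_card_n by metis
next
  case False
  then show ?thesis using that infinite_arbitrarily_large by metis
qed

text \<open>The argument uses degrees only through upper bounds, and these survive when the lists are
  shrunk to exact sizes. Degrees in \<open>H\<close> bound \<open>reach\<close> and \<open>coreach\<close>; two adjacent lists belong to adjacent
  vertices of \<open>G\<close>, so degrees in \<open>G\<close> bound \<open>nbrs_A\<close> and \<open>nbrs_B\<close>.\<close>

lemma independent_transversal_one_sided:
  fixes G :: "'a ugraph" and H :: "'b ugraph"
  assumes G: "bipartition G A B" and H: "bipartition H A' B'"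
    and cover: "bipartite_correspondence_cover G A B H A' B' L"
    and pos: "1 \<le> k" "1 \<le> l"
    and cond: "(k \<ge> 2 \<and> real l \<ge> (exp 1 * real k * real D') powr (1 / (real k - 1)) * real D)
      \<or> exp 1 * (real k * real D * (real l * real D' - 1) + 1)
          * (1 - (1 - 1 / real l) ^ D) ^ k \<le> 1
      \<or> (\<exists>a b. max_degree G A = enat a \<and> max_degree G B = enat b \<and>
          exp 1 * (real a * (real b - 1) + 1)
            * (1 - rpow (1 - 1 / real l) (real a * min 1 (real l / real k))) ^ k \<le> 1)"
    and D: "max_degree H A' = enat D" "max_degree H B' = enat D'"
    and size: "\<forall>v\<in>A. enat k \<le> ecard (L v)" "\<forall>w\<in>B. enat l \<le> ecard (L w)"
  shows "\<exists>T. independent_transversal G H L T"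
proof -
  have AB: "A \<inter> B = {}" "A \<union> B = verts G" using G by (auto simp: bipartition_def)
  have cov: "bipartite_cover G A B H A' B' L"
    and mat: "\<And>v w. v \<in> verts G \<Longrightarrow> w \<in> verts G \<Longrightarrow> {v, w} \<in> edges G \<Longrightarrow>
      matching (edges_between H (L v) (L w))"
    using cover by (auto simp: bipartite_correspondence_cover_def)
  have disj: "disjoint_family_on L (verts G)"
    and noedge: "\<And>v w. v \<in> verts G \<Longrightarrow> w \<in> verts G \<Longrightarrow> {v, w} \<notin> edges G \<Longrightarrow>
      edges_between H (L v) (L w) = {}"
    and unH: "(\<Union>v\<in>verts G. L v) = verts H" and unA: "(\<Union>v\<in>A. L v) = A'" and unB: "(\<Union>w\<in>B. L w) = B'"
    using cov unfolding bipartite_cover_def by blast+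
  have same: "v = w" if "v \<in> verts G" "w \<in> verts G" "x \<in> L v" "x \<in> L w" for v w x
    using disj that unfolding disjoint_family_on_def by blast
  have between: "{v, w} \<in> edges G \<and> {x, y} \<in> edges_between H (L v) (L w)"
    if "v \<in> verts G" "w \<in> verts G" "x \<in> L v" "y \<in> L w" "{x, y} \<in> edges H" for v w x y
  proof -
    have "{x, y} \<in> edges_between H (L v) (L w)" using that by (auto simp: edges_between_def)
    with noedge[OF that(1,2)] show ?thesis by blast
  qed
  have once: "{x, y} = {x', y'}"
    if v: "v \<in> A" "w \<in> B" and e: "x \<in> L v" "y \<in> L w" "{x, y} \<in> edges H"
      and e': "x' \<in> L v" "y' \<in> L w" "{x', y'} \<in> edges H" and meet: "x = x' \<or> y = y'" for v w x y x' y'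
  proof -
    have V: "v \<in> verts G" "w \<in> verts G" using v AB by auto
    have "pairwise disjnt (edges_between H (L v) (L w))"
      using mat[OF V] between[OF V e] by (auto simp: matching_def)
    moreover have "{x, y} \<in> edges_between H (L v) (L w)" "{x', y'} \<in> edges_between H (L v) (L w)"
      using between[OF V e] between[OF V e'] by simp_all
    ultimately have "{x, y} = {x', y'} \<or> disjnt {x, y} {x', y'}"
      unfolding pairwise_def by metis
    then show ?thesis using meet by (auto simp: disjnt_def)
  qed
  have "\<forall>v\<in>verts G. \<exists>T. T \<subseteq> L v \<and> finite T \<and> card T = (if v \<in> A then k else l)"
  proof
    fix v assume "v \<in> verts G"
    then have "enat (if v \<in> A then k else l) \<le> ecard (L v)" using size AB by auto
    then show "\<exists>T. T \<subseteq> L v \<and> finite T \<and> card T = (if v \<in> A then k else l)"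
      by (elim subset_with_card_le_ecard) blast
  qed
  from bchoice[OF this] obtain M
    where M: "\<And>v. v \<in> verts G \<Longrightarrow> M v \<subseteq> L v \<and> finite (M v) \<and> card (M v) = (if v \<in> A then k else l)"
    by blast
  define adj where "adj x y \<longleftrightarrow> {x, y} \<in> edges H" for x y
  interpret list_cover A B M adj k l
  proof
    show "finite (M v) \<and> card (M v) = k" if "v \<in> A" for v using M[of v] AB that by auto
    show "finite (M w) \<and> card (M w) = l" if "w \<in> B" for w
    proof -
      have "w \<in> verts G" "w \<notin> A" using AB that by auto
      then show ?thesis using M[of w] by simp
    qed
    show "disjoint_family_on M A"
      unfolding disjoint_family_on_def
    proof (intro ballI impI)
      fix v w assume "v \<in> A" "w \<in> A" "v \<noteq> w"
      then show "M v \<inter> M w = {}" using M[of v] M[of w] same[of v w] AB by blast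
    qed
    fix v w x y assume vw: "v \<in> A" "w \<in> B" and xy: "x \<in> M v" "y \<in> M w" "adj x y"
    have sub: "M v \<subseteq> L v" "M w \<subseteq> L w" using M AB vw by auto
    show "y = y'" if "y' \<in> M w" "adj x y'" for y'
      using once[OF vw, of x y x y'] sub xy that by (auto simp: adj_def doubleton_eq_iff)
    show "x = x'" if "x' \<in> M v" "adj x' y" for x'
      using once[OF vw, of x y x' y] sub xy that by (auto simp: adj_def doubleton_eq_iff)
  qed (use pos in auto)
  have MA: "M v \<subseteq> L v" if "v \<in> A" for v using M[of v] AB that by auto
  have MB: "M w \<subseteq> L w" if "w \<in> B" for w using M[of w] AB that by auto
  have deg_reach: "finite (reach x) \<and> card (reach x) \<le> D" if v: "v \<in> A" "x \<in> M v" for v x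
  proof -
    have "x \<in> A'" using v MA unA by blast
    have "finite (\<Union>y\<in>neighbours H x. {w \<in> B. y \<in> L w}) \<and>
        card (\<Union>y\<in>neighbours H x. {w \<in> B. y \<in> L w}) \<le> D * 1"
    proof (rule card_UN_le_mult)
      fix y
      have "finite {w \<in> B. y \<in> L w} \<and> card {w \<in> B. y \<in> L w} \<le> Suc 0"
      proof (cases "\<exists>w\<in>B. y \<in> L w")
        case True
        then obtain w where "w \<in> B" "y \<in> L w" by blast
        then have "{w \<in> B. y \<in> L w} \<subseteq> {w}" using same AB by blast
        then show ?thesis by (rule finite_card_le_subset) simp
      next
        case False
        then have empty: "{w \<in> B. y \<in> L w} = {}" by blast
        show ?thesis unfolding empty by simp
      qed
      then show "finite {w \<in> B. y \<in> L w} \<and> card {w \<in> B. y \<in> L w} \<le> 1" by simp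
    qed (use degree_le_max_degree[OF D(1) \<open>x \<in> A'\<close>] in auto)
    moreover have "reach x \<subseteq> (\<Union>y\<in>neighbours H x. {w \<in> B. y \<in> L w})"
      using MB by (auto simp: reach_def neighbours_def adj_def)
    ultimately show ?thesis using finite_card_le_subset by simp
  qed
  have deg_coreach: "finite (coreach y) \<and> card (coreach y) \<le> D'" if w: "w \<in> B" "y \<in> M w" for w y
  proof (rule finite_card_le_subset)
    have "y \<in> B'" using w MB unB by blast
    then show "finite (neighbours H y) \<and> card (neighbours H y) \<le> D'"
      by (rule degree_le_max_degree[OF D(2)])
    show "coreach y \<subseteq> neighbours H y"
      by (auto simp: coreach_def neighbours_def adj_def insert_commute)
  qed
  have nbr: "{v, w} \<in> edges G" if vw: "v \<in> A" "w \<in> nbrs_A v" for v w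
  proof -
    obtain x y where "x \<in> M v" "w \<in> B" "y \<in> M w" "{x, y} \<in> edges H"
      using vw(2) by (auto simp: nbrs_A_def reach_def adj_def)
    then show ?thesis using between[of v w x y] MA MB vw(1) AB by blast
  qed
  obtain f where f: "f \<in> PiE B M" "extendable f"
  proof -
    from cond have "\<exists>f\<in>PiE B M. extendable f"
    proof (elim disjE exE conjE)
      assume "2 \<le> k" "(exp 1 * real k * real D') powr (1 / (real k - 1)) * real D \<le> real l"
      then show ?thesis using extendable_if_list_size_large deg_reach deg_coreach by blast
    next
      assume "exp 1 * (real k * real D * (real l * real D' - 1) + 1)
          * (1 - (1 - 1 / real l) ^ D) ^ k \<le> 1"
      then show ?thesis using extendable_if_cover_degrees_small deg_reach deg_coreach by blast
    next
      fix a b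
      assume ab: "max_degree G A = enat a" "max_degree G B = enat b"
        and e: "exp 1 * (real a * (real b - 1) + 1)
            * (1 - rpow (1 - 1 / real l) (real a * min 1 (real l / real k))) ^ k \<le> 1"
      show ?thesis
      proof (rule extendable_if_base_degrees_small[OF _ _ e])
        fix v assume v: "v \<in> A"
        show "finite (nbrs_A v) \<and> card (nbrs_A v) \<le> a"
          using nbr[OF v] by (intro finite_card_le_subset[OF _ degree_le_max_degree[OF ab(1) v]])
            (auto simp: neighbours_def)
      next
        fix w assume w: "w \<in> B"
        show "finite (nbrs_B w) \<and> card (nbrs_B w) \<le> b"
          using nbr by (intro finite_card_le_subset[OF _ degree_le_max_degree[OF ab(2) w]])
            (auto simp: neighbours_def nbrs_B_def insert_commute)
      qed
    qed
    then show ?thesis using that by blast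
  qed
  from f(2) have "\<forall>v\<in>A. \<exists>x. x \<in> M v \<and> (\<forall>w\<in>B. \<not> adj x (f w))"
    unfolding extendable_def by blast
  from bchoice[OF this] obtain g
    where g: "\<And>v. v \<in> A \<Longrightarrow> g v \<in> M v" "\<And>v w. v \<in> A \<Longrightarrow> w \<in> B \<Longrightarrow> \<not> adj (g v) (f w)"
    by blast
  define h where "h v = (if v \<in> A then g v else f v)" for v
  have h: "h v \<in> L v" if v: "v \<in> verts G" for v
    using v g(1) f(1) M[OF v] AB by (auto simp: h_def)
  have "independent_transversal G H L (h ` verts G)"
    unfolding independent_transversal_def independent_set_def
  proof (intro conjI ballI)
    show "h ` verts G \<subseteq> verts H" using h unH by blast
  next
    fix v assume v: "v \<in> verts G"
    show "\<exists>!x. x \<in> h ` verts G \<inter> L v"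
    proof (rule ex1I)
      show "h v \<in> h ` verts G \<inter> L v" using h v by blast
      fix x assume "x \<in> h ` verts G \<inter> L v"
      then obtain u where "u \<in> verts G" "x = h u" "x \<in> L v" by blast
      then show "x = h v" using h same v by blast
    qed
  next
    have no: "{h u, h u'} \<notin> edges H" if u: "u \<in> A" "u' \<in> B" for u u'
      using g(2)[OF u] u AB by (auto simp: h_def adj_def)
    fix x y assume "x \<in> h ` verts G" "y \<in> h ` verts G"
    then obtain u u' where u: "u \<in> verts G" "u' \<in> verts G" "x = h u" "y = h u'" by blast
    have inA: "t \<in> A" if "t \<in> verts G" "h t \<in> A'" for t
      using same[OF _ that(1) _ h[OF that(1)]] that unA AB by blast
    have inB: "t \<in> B" if "t \<in> verts G" "h t \<in> B'" for t
      using same[OF _ that(1) _ h[OF that(1)]] that unB AB by blast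
    show "{x, y} \<notin> edges H"
    proof
      assume e: "{x, y} \<in> edges H"
      have "\<forall>e\<in>edges H. \<exists>a\<in>A'. \<exists>b\<in>B'. e = {a, b}"
        using H by (simp add: bipartition_def)
      from bspec[OF this e] obtain a b where ab: "a \<in> A'" "b \<in> B'" "{x, y} = {a, b}"
        by (elim bexE)
      then consider "x = a" "y = b" | "x = b" "y = a" by (auto simp: doubleton_eq_iff)
      then show False
      proof cases
        case 1
        then show False using no[of u u'] inA[of u] inB[of u'] u ab e by auto
      next
        case 2
        then show False using no[of u' u] inA[of u'] inB[of u] u ab e by (auto simp: insert_commute)
      qed
    qed
  qed
  then show ?thesis by blast
qed

lemma bipartition_swap: "bipartition G A B \<Longrightarrow> bipartition G B A"
  unfolding bipartition_def by (metis Int_commute Un_commute insert_commute)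

lemma bipartite_correspondence_cover_swap:
  "bipartite_correspondence_cover G A B H A' B' L \<Longrightarrow> bipartite_correspondence_cover G B A H B' A' L"
  unfolding bipartite_correspondence_cover_def bipartite_cover_def by blast

theorem theorem2:
  fixes G :: "'a ugraph" and H :: "'b ugraph"
    and A\<^sub>G B\<^sub>G :: "'a set" and A\<^sub>H B\<^sub>H :: "'b set"
    and L :: "'a \<Rightarrow> 'b set"
    and k\<^sub>A k\<^sub>B D\<^sub>A D\<^sub>B :: nat
    and \<Delta>\<^sub>A \<Delta>\<^sub>B :: enat
  assumes "simple_graph G" and "simple_graph H"
    and "bipartition G A\<^sub>G B\<^sub>G" and "bipartition H A\<^sub>H B\<^sub>H"
    and "bipartite_correspondence_cover G A\<^sub>G B\<^sub>G H A\<^sub>H B\<^sub>H L"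
    and "k\<^sub>A \<ge> 1" and "k\<^sub>B \<ge> 1"
    and conditions:
      "(k\<^sub>A \<ge> 2 \<and>
         real k\<^sub>B \<ge> (exp 1 * real k\<^sub>A * real D\<^sub>B) powr (1 / (real k\<^sub>A - 1)) * real D\<^sub>A)
     \<or> (k\<^sub>B \<ge> 2 \<and>
         real k\<^sub>A \<ge> (exp 1 * real k\<^sub>B * real D\<^sub>A) powr (1 / (real k\<^sub>B - 1)) * real D\<^sub>B)
     \<or> exp 1 * (real k\<^sub>A * real D\<^sub>A * (real k\<^sub>B * real D\<^sub>B - 1) + 1)
         * (1 - (1 - 1 / real k\<^sub>B) ^ D\<^sub>A) ^ k\<^sub>A \<le> 1
     \<or> exp 1 * (real k\<^sub>B * real D\<^sub>B * (real k\<^sub>A * real D\<^sub>A - 1) + 1)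
         * (1 - (1 - 1 / real k\<^sub>A) ^ D\<^sub>B) ^ k\<^sub>B \<le> 1
     \<or> (\<exists>a b :: nat. \<Delta>\<^sub>A = enat a \<and> \<Delta>\<^sub>B = enat b \<and>
         exp 1 * (real a * (real b - 1) + 1)
         * (1 - rpow (1 - 1 / real k\<^sub>B) (real a * min 1 (real k\<^sub>B / real k\<^sub>A))) ^ k\<^sub>A \<le> 1)
     \<or> (\<exists>a b :: nat. \<Delta>\<^sub>A = enat a \<and> \<Delta>\<^sub>B = enat b \<and>
         exp 1 * (real b * (real a - 1) + 1)
         * (1 - rpow (1 - 1 / real k\<^sub>A) (real b * min 1 (real k\<^sub>A / real k\<^sub>B))) ^ k\<^sub>B \<le> 1)"
    and "\<Delta>\<^sub>A = \<infinity> \<or> max_degree G A\<^sub>G = \<Delta>\<^sub>A"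
    and "\<Delta>\<^sub>B = \<infinity> \<or> max_degree G B\<^sub>G = \<Delta>\<^sub>B"
    and "max_degree H A\<^sub>H = enat D\<^sub>A"
    and "max_degree H B\<^sub>H = enat D\<^sub>B"
    and "\<forall>v\<in>A\<^sub>G. enat k\<^sub>A \<le> ecard (L v)"
    and "\<forall>w\<in>B\<^sub>G. enat k\<^sub>B \<le> ecard (L w)"
  shows "\<exists>T. independent_transversal G H L T"
proof -
  note from_B = independent_transversal_one_sided[OF assms(3,4,5,6,7) _ assms(11,12,13,14)]
  note from_A = independent_transversal_one_sided[OF bipartition_swap[OF assms(3)]
      bipartition_swap[OF assms(4)] bipartite_correspondence_cover_swap[OF assms(5)]
      assms(7,6) _ assms(12,11,14,13)]
  have degs: "max_degree G A\<^sub>G = enat a \<and> max_degree G B\<^sub>G = enat b"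
    if "\<Delta>\<^sub>A = enat a" "\<Delta>\<^sub>B = enat b" for a b
    using assms(9,10) that by auto
  from conditions show ?thesis
  proof (elim disjE)
    assume "k\<^sub>A \<ge> 2 \<and>
         real k\<^sub>B \<ge> (exp 1 * real k\<^sub>A * real D\<^sub>B) powr (1 / (real k\<^sub>A - 1)) * real D\<^sub>A"
    then show ?thesis by (intro from_B disjI1)
  next
    assume "k\<^sub>B \<ge> 2 \<and>
         real k\<^sub>A \<ge> (exp 1 * real k\<^sub>B * real D\<^sub>A) powr (1 / (real k\<^sub>B - 1)) * real D\<^sub>B"
    then show ?thesis by (intro from_A disjI1)
  next
    assume "exp 1 * (real k\<^sub>A * real D\<^sub>A * (real k\<^sub>B * real D\<^sub>B - 1) + 1)
         * (1 - (1 - 1 / real k\<^sub>B) ^ D\<^sub>A) ^ k\<^sub>A \<le> 1"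
    then show ?thesis by - (rule from_B, rule disjI2, rule disjI1)
  next
    assume "exp 1 * (real k\<^sub>B * real D\<^sub>B * (real k\<^sub>A * real D\<^sub>A - 1) + 1)
         * (1 - (1 - 1 / real k\<^sub>A) ^ D\<^sub>B) ^ k\<^sub>B \<le> 1"
    then show ?thesis by - (rule from_A, rule disjI2, rule disjI1)
  next
    assume "\<exists>a b :: nat. \<Delta>\<^sub>A = enat a \<and> \<Delta>\<^sub>B = enat b \<and>
         exp 1 * (real a * (real b - 1) + 1)
         * (1 - rpow (1 - 1 / real k\<^sub>B) (real a * min 1 (real k\<^sub>B / real k\<^sub>A))) ^ k\<^sub>A \<le> 1"
    then show ?thesis using degs by (intro from_B disjI2) blast
  next
    assume "\<exists>a b :: nat. \<Delta>\<^sub>A = enat a \<and> \<Delta>\<^sub>B = enat b \<and>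
         exp 1 * (real b * (real a - 1) + 1)
         * (1 - rpow (1 - 1 / real k\<^sub>A) (real b * min 1 (real k\<^sub>A / real k\<^sub>B))) ^ k\<^sub>B \<le> 1"
    then show ?thesis using degs by (intro from_A disjI2) blast
  qed
qed

end
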